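(* For each integer $\tau\ge 0$ there is a signed graph with flexibility $\tau$ that achieves $\binom{\tau+2}{2}$ Laplacian inertias.
   Context: A signed graph is a simple graph $G=(V(G),E(G))$ with vertex set $V(G)=\{1,\dots,n\}$ together with an assignment of a sign $+$ or $-$ to each edge. A consistent weighting $\gamma$ of $G$ assigns to each edge $ij$ a nonzero real number $\gamma_{ij}$ whose sign is the sign of the edge; $\Gamma=(G,\gamma)$ is then a weighted signed graph. Its Laplacian is $L(\Gamma)=A-D$, where $A=[a_{ij}]$ is the symmetric $n\times n$ matrix with $a_{ij}=\gamma_{ij}$ if $ij\in E(G)$ and $a_{ij}=0$ otherwise, and $D=\mathrm{diag}(d_1,\dots,d_n)$ with $d_i$ the sum of the weights of the edges incident to vertex $i$. The Laplacian inertia of $\Gamma$ is $IL(\Gamma)=(n_+,n_-,n_0)$, the numbers of positive, negative and zero eigenvalues of $L(\Gamma)$, counted with multiplicity. $G$ achieves a triple $(n_+,n_-,n_0)$ if $IL(G,\gamma)=(n_+,n_-,n_0)$ for some consistent weighting $\gamma$ of $G$; the number of Laplacian inertias achieved by $G$ is the number of distinct such triples. Let $c$ be the number of connected components of $G$, and let $c_+$ (resp. $c_-$) be the number of connected components of the spanning subgraph $G_+$ (resp. $G_-$) of $G$ consisting of all vertices and only the positive (resp. negative) edges. The flexibility of $G$ is $\tau=n+c-c_+-c_-$. *)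

theory Defs
  imports "Jordan_Normal_Form.Char_Poly"
begin

datatype sign = Plus | Minus

text \<open>
  The vertices of a signed graph with \<open>n\<close> vertices are \<open>0, \<dots>, n - 1\<close> (not \<open>1, \<dots>, n\<close>), so that they
  are the row and column indices of its matrices. Edges are two-element sets of vertices;
  the values of \<open>edge_sign\<close> outside \<open>edges\<close> are irrelevant.
\<close>

record signed_graph =
  nverts :: nat
  edges :: "nat set set"
  edge_sign :: "nat set \<Rightarrow> sign"

definition verts :: "signed_graph \<Rightarrow> nat set" where
  "verts G = {..<nverts G}"

definition is_signed_graph :: "signed_graph \<Rightarrow> bool" where
  "is_signed_graph G \<longleftrightarrow> nverts G \<ge> 1 \<and> (\<forall>e\<in>edges G. e \<subseteq> verts G \<and> card e = 2)"

definition edges_of_sign :: "signed_graph \<Rightarrow> sign \<Rightarrow> nat set set" where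
  "edges_of_sign G s = {e \<in> edges G. edge_sign G e = s}"

definition components :: "nat set \<Rightarrow> nat set set \<Rightarrow> nat set set" where
  "components V E = V // {(u, v) \<in> V \<times> V. (u, v) \<in> {(x, y). {x, y} \<in> E}\<^sup>*}"

definition flexibility :: "signed_graph \<Rightarrow> int" where
  "flexibility G = int (nverts G) + int (card (components (verts G) (edges G)))
     - int (card (components (verts G) (edges_of_sign G Plus)))
     - int (card (components (verts G) (edges_of_sign G Minus)))"

definition consistent_weighting :: "signed_graph \<Rightarrow> (nat set \<Rightarrow> real) \<Rightarrow> bool" where
  "consistent_weighting G \<gamma> \<longleftrightarrow>
     (\<forall>e\<in>edges G. case edge_sign G e of Plus \<Rightarrow> \<gamma> e > 0 | Minus \<Rightarrow> \<gamma> e < 0)"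

definition weighted_adjacency :: "signed_graph \<Rightarrow> (nat set \<Rightarrow> real) \<Rightarrow> real mat" where
  "weighted_adjacency G \<gamma> =
     mat (nverts G) (nverts G) (\<lambda>(i, j). if {i, j} \<in> edges G then \<gamma> {i, j} else 0)"

definition weighted_degree :: "signed_graph \<Rightarrow> (nat set \<Rightarrow> real) \<Rightarrow> nat \<Rightarrow> real" where
  "weighted_degree G \<gamma> i = (\<Sum>e | e \<in> edges G \<and> i \<in> e. \<gamma> e)"

definition degree_mat :: "signed_graph \<Rightarrow> (nat set \<Rightarrow> real) \<Rightarrow> real mat" where
  "degree_mat G \<gamma> =
     mat (nverts G) (nverts G) (\<lambda>(i, j). if i = j then weighted_degree G \<gamma> i else 0)"

definition laplacian :: "signed_graph \<Rightarrow> (nat set \<Rightarrow> real) \<Rightarrow> real mat" where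
  "laplacian G \<gamma> = weighted_adjacency G \<gamma> - degree_mat G \<gamma>"

text \<open>
  Multiplicity is algebraic multiplicity; for the real symmetric matrices to which this is
  applied it agrees with geometric multiplicity, and all complex eigenvalues are real.
\<close>

definition num_eigenvalues :: "real mat \<Rightarrow> (real \<Rightarrow> bool) \<Rightarrow> nat" where
  "num_eigenvalues A P = (\<Sum>x | eigenvalue A x \<and> P x. order x (char_poly A))"

definition laplacian_inertia :: "signed_graph \<Rightarrow> (nat set \<Rightarrow> real) \<Rightarrow> nat \<times> nat \<times> nat" where
  "laplacian_inertia G \<gamma> =
     (num_eigenvalues (laplacian G \<gamma>) (\<lambda>x. x > 0),
      num_eigenvalues (laplacian G \<gamma>) (\<lambda>x. x < 0),
      num_eigenvalues (laplacian G \<gamma>) (\<lambda>x. x = 0))"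

definition achieves :: "signed_graph \<Rightarrow> nat \<times> nat \<times> nat \<Rightarrow> bool" where
  "achieves G t \<longleftrightarrow> (\<exists>\<gamma>. consistent_weighting G \<gamma> \<and> laplacian_inertia G \<gamma> = t)"

end

theory Submission imports Defs begin

text \<open>
  A triangle with two positive edges of weights \<open>u\<close>, \<open>v\<close> and one negative edge of weight \<open>-w\<close> has
  flexibility 1, and its Laplacian has characteristic polynomial
  \<open>x (x\<^sup>2 + 2 (u + v - w) x + 3 (u v - w (u + v)))\<close>. The sign of the constant coefficient of the
  quadratic factor decides between the inertias \<open>(1, 1, 1)\<close>, \<open>(0, 1, 2)\<close> and \<open>(0, 2, 1)\<close>; the linear
  coefficient is positive whenever the constant one is nonnegative, so \<open>(2, 0, 1)\<close> does not occur.
  Flexibility and inertia are additive over disjoint unions, and an isolated vertex has flexibility 0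
  and inertia \<open>(0, 0, 1)\<close>. Hence the union of \<open>\<tau>\<close> such triangles and an isolated vertex (which keeps the
  vertex set nonempty for \<open>\<tau> = 0\<close>) achieves exactly the triples \<open>(a, \<tau> + b, 1 + \<tau> + c)\<close> with
  \<open>a + b + c = \<tau>\<close>.
\<close>

section \<open>Counting connected components\<close>

lemma rtrancl_invariant:
  assumes "\<And>x y. (x, y) \<in> R \<Longrightarrow> f x = f y" and "(x, y) \<in> R\<^sup>*"
  shows "f x = f y"
  using assms(2) by induction (auto dest: assms(1))

text \<open>\<open>f\<close> acts as a complete invariant of connectedness: \<open>edge\<close>
  makes it constant along walks and \<open>reach\<close> joins any two vertices with the same value.
  The components are therefore the nonempty fibres of \<open>f\<close>. Walks range over all
  naturals, and \<open>sub\<close> confines their edges to \<open>V\<close>.\<close>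

lemma card_components_eq:
  assumes edge: "\<And>x y. x \<in> V \<Longrightarrow> y \<in> V \<Longrightarrow> {x, y} \<in> E \<Longrightarrow> f x = f y"
    and sub: "\<And>e. e \<in> E \<Longrightarrow> e \<subseteq> V"
    and reach: "\<And>x y. x \<in> V \<Longrightarrow> y \<in> V \<Longrightarrow> f x = f y \<Longrightarrow> (x, y) \<in> {(x, y). {x, y} \<in> E}\<^sup>*"
  shows "card (components V E) = card (f ` V)"
proof -
  have "f x = f y" if "(x, y) \<in> {(x, y). {x, y} \<in> E}\<^sup>*" for x y
    by (rule rtrancl_invariant[OF _ that]) (use edge sub in blast)
  then have rel: "{(u, v) \<in> V \<times> V. (u, v) \<in> {(x, y). {x, y} \<in> E}\<^sup>*} =
      {(u, v) \<in> V \<times> V. f u = f v}"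
    using reach by auto
  define C where "C = (\<lambda>a. {v \<in> V. f v = a})"
  have "{(u, v) \<in> V \<times> V. f u = f v} `` {x} = C (f x)" if "x \<in> V" for x
    using that by (auto simp: C_def)
  then have "components V E = C ` f ` V"
    unfolding components_def rel quotient_def by auto
  moreover have "inj_on C (f ` V)"
    by (rule inj_onI) (auto simp: C_def)
  ultimately show ?thesis
    by (simp add: card_image)
qed

section \<open>Components of a disjoint union\<close>

lemma reach_mono:
  assumes "(x, y) \<in> {(x, y). {x, y} \<in> E}\<^sup>*" "E \<subseteq> F"
  shows "(x, y) \<in> {(x, y). {x, y} \<in> F}\<^sup>*"
  by (rule rtrancl_mono[THEN subsetD, OF _ assms(1)]) (use assms(2) in auto)

text \<open>For \<open>v\<close> in \<open>V\<close> this is the class of \<open>v\<close> in the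
  quotient \<open>components V E\<close>. It serves as a vertex label for
  \<open>card_components_eq\<close> when the components are not known explicitly.\<close>

definition component_of :: "nat set \<Rightarrow> nat set set \<Rightarrow> nat \<Rightarrow> nat set" where
  "component_of V E v = {u \<in> V. (v, u) \<in> {(x, y). {x, y} \<in> E}\<^sup>*}"

lemma components_conv_component_of: "components V E = component_of V E ` V"
  unfolding components_def quotient_def component_of_def by fastforce

lemma component_of_edge:
  assumes "{x, y} \<in> E"
  shows "component_of V E x = component_of V E y"
proof -
  have "(x, y) \<in> {(x, y). {x, y} \<in> E}" "(y, x) \<in> {(x, y). {x, y} \<in> E}"
    using assms by (auto simp: insert_commute)
  then show ?thesis
    unfolding component_of_def by (blast intro: converse_rtrancl_into_rtrancl)
qed

lemma component_of_eqD:
  assumes "component_of V E x = component_of V E y" "y \<in> V"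
  shows "(x, y) \<in> {(x, y). {x, y} \<in> E}\<^sup>*"
proof -
  have "y \<in> component_of V E y"
    using assms(2) by (simp add: component_of_def)
  then show ?thesis
    using assms(1) by (auto simp: component_of_def)
qed

lemma image_plus_insert: "(+) n ` {x, y} = {n + x, n + y :: nat}"
  by simp

text \<open>Label each vertex by its component in its own part, tagged \<open>Inl\<close> or
  \<open>Inr\<close>. This labelling is a complete invariant of connectedness in the union, and its
  image is the disjoint sum of the two sets of components.\<close>

lemma card_components_disjoint_union:
  fixes n m :: nat
  assumes E: "\<And>e. e \<in> E \<Longrightarrow> e \<subseteq> {..<n} \<and> e \<noteq> {}" and F: "\<And>e. e \<in> F \<Longrightarrow> e \<subseteq> {..<m} \<and> e \<noteq> {}"
  shows "card (components {..<n + m} (E \<union> (`) ((+) n) ` F)) =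
    card (components {..<n} E) + card (components {..<m} F)"
proof -
  let ?E = "E \<union> (`) ((+) n) ` F"
  define f where "f = (\<lambda>v. if v < n then Inl (component_of {..<n} E v)
    else Inr (component_of {..<m} F (v - n)))"
  have "card (components {..<n + m} ?E) = card (f ` {..<n + m})"
  proof (rule card_components_eq)
    fix x y assume "{x, y} \<in> ?E"
    then consider "{x, y} \<in> E" | g where "g \<in> F" "{x, y} = (+) n ` g" by auto
    then show "f x = f y"
    proof cases
      case 1
      then show ?thesis using E[OF 1] component_of_edge[OF 1] by (simp add: f_def)
    next
      case 2
      then have "x \<in> (+) n ` g" "y \<in> (+) n ` g" by auto
      then obtain a b where ab: "x = n + a" "y = n + b" by auto
      then have "(+) n ` {a, b} = (+) n ` g" using 2 by simp
      then have "g = {a, b}" by (subst (asm) inj_image_eq_iff) auto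
      then show ?thesis using 2 ab component_of_edge[of a b F] by (simp add: f_def)
    qed
  next
    fix e assume "e \<in> ?E"
    then show "e \<subseteq> {..<n + m}" using E F by fastforce
  next
    fix x y assume xy: "x \<in> {..<n + m}" "y \<in> {..<n + m}" "f x = f y"
    show "(x, y) \<in> {(x, y). {x, y} \<in> ?E}\<^sup>*"
    proof (cases "x < n")
      case True
      then have "y < n" "component_of {..<n} E x = component_of {..<n} E y"
        using xy by (auto simp: f_def split: if_splits)
      then have "(x, y) \<in> {(x, y). {x, y} \<in> E}\<^sup>*" by (intro component_of_eqD) auto
      then show ?thesis by (rule reach_mono) simp
    next
      case False
      then have y: "\<not> y < n" "component_of {..<m} F (x - n) = component_of {..<m} F (y - n)"
        using xy by (auto simp: f_def split: if_splits)
      \<comment> \<open>The shift by \<open>n\<close> carries a walk along \<open>F\<close>, edge by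
        edge, to a walk along the shifted copy.\<close>
      have *: "(n + a, n + b) \<in> {(x, y). {x, y} \<in> ?E}\<^sup>*"
        if "(a, b) \<in> {(x, y). {x, y} \<in> F}\<^sup>*" for a b
        using that
      proof induction
        case (step b c)
        then have "{n + b, n + c} \<in> ?E"
          unfolding image_plus_insert[symmetric] by blast
        with step.IH show ?case by (auto intro: rtrancl_into_rtrancl)
      qed simp
      have "(x - n, y - n) \<in> {(x, y). {x, y} \<in> F}\<^sup>*"
        using y xy by (intro component_of_eqD) auto
      from *[OF this] show ?thesis using False y by simp
    qed
  qed
  also have "f ` {..<n + m} = components {..<n} E <+> components {..<m} F"
  proof -
    have "{..<n + m} = {..<n} \<union> {n..<n + m}"
      by auto
    also have "{n..<n + m} = (+) n ` {..<m}"
      by (simp add: lessThan_atLeast0 add.commute)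
    finally have "f ` {..<n + m} = f ` {..<n} \<union> (f \<circ> (+) n) ` {..<m}"
      by (simp add: image_Un image_comp)
    also have "f ` {..<n} = Inl ` components {..<n} E"
      by (auto simp: f_def components_conv_component_of image_iff)
    also have "(f \<circ> (+) n) ` {..<m} = Inr ` components {..<m} F"
      by (auto simp: f_def components_conv_component_of image_iff)
    finally show ?thesis by (simp add: Plus_def)
  qed
  finally show ?thesis
    by (simp add: card_Plus components_conv_component_of)
qed

section \<open>Counting roots of polynomials\<close>

text \<open>The root-counting part of \<open>num_eigenvalues\<close>, stated for an arbitrary
  polynomial so that the factors of a characteristic polynomial can be treated separately.\<close>

definition num_roots :: "real poly \<Rightarrow> (real \<Rightarrow> bool) \<Rightarrow> nat" where
  "num_roots p P = (\<Sum>x | poly p x = 0 \<and> P x. order x p)"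

text \<open>Points that are not roots have order 0, so enlarging the index set adds nothing. This
  allows several polynomials to be summed over one common set.\<close>

lemma num_roots_superset:
  assumes "p \<noteq> 0" "finite S" "\<And>x. poly p x = 0 \<Longrightarrow> P x \<Longrightarrow> x \<in> S" "\<And>x. x \<in> S \<Longrightarrow> P x"
  shows "num_roots p P = (\<Sum>x\<in>S. order x p)"
  unfolding num_roots_def
  by (rule sum.mono_neutral_left) (use assms in \<open>auto simp: order_root\<close>)

text \<open>Both counts are taken over the roots of the product, where orders add pointwise.\<close>

lemma num_roots_mult:
  assumes "p \<noteq> 0" "q \<noteq> 0"
  shows "num_roots (p * q) P = num_roots p P + num_roots q P"
proof -
  let ?S = "{x. poly (p * q) x = 0 \<and> P x}"
  have fin: "finite ?S"
    using poly_roots_finite[of "p * q"] assms by (auto intro: rev_finite_subset)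
  have "num_roots p P = (\<Sum>x\<in>?S. order x p)" "num_roots q P = (\<Sum>x\<in>?S. order x q)"
    by (rule num_roots_superset; use assms fin in simp)+
  then show ?thesis
    using assms by (simp add: num_roots_def order_mult sum.distrib del: poly_mult)
qed

lemma num_roots_linear: "num_roots [:- r, 1:] P = (if P r then 1 else 0)"
proof -
  have "{x. poly [:- r, 1:] x = 0 \<and> P x} = (if P r then {r} else {})"
    by auto
  then show ?thesis
    using order_power_n_n[of r 1] by (simp add: num_roots_def)
qed

section \<open>Eigenvalue counts through characteristic polynomials\<close>

lemma char_poly_nonzero:
  assumes "A \<in> carrier_mat n n"
  shows "char_poly A \<noteq> (0 :: 'a :: comm_ring_1 poly)"
  using degree_monic_char_poly[OF assms] by (metis coeff_0 zero_neq_one)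

lemma num_eigenvalues_eq:
  assumes "A \<in> carrier_mat n n"
  shows "num_eigenvalues A P = num_roots (char_poly A) P"
  unfolding num_eigenvalues_def num_roots_def eigenvalue_root_char_poly[OF assms] ..

text \<open>The characteristic matrix is again block diagonal, so its determinant is the product of
  the determinants of its blocks.\<close>

lemma char_poly_block_diag:
  fixes A B :: "'a :: idom mat"
  assumes A: "A \<in> carrier_mat n n" and B: "B \<in> carrier_mat m m"
  shows "char_poly (four_block_mat A (0\<^sub>m n m) (0\<^sub>m m n) B) = char_poly A * char_poly B"
proof -
  have "char_poly_matrix (four_block_mat A (0\<^sub>m n m) (0\<^sub>m m n) B) =
      four_block_mat (char_poly_matrix A) (0\<^sub>m n m) (0\<^sub>m m n) (char_poly_matrix B)"
    using A B by (intro eq_matI) (auto simp: char_poly_matrix_def)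
  then show ?thesis
    unfolding char_poly_def
    using A B by (subst det_four_block_mat_lower_left_zero[symmetric, where n = n and m = m]) auto
qed

lemma num_eigenvalues_block_diag:
  assumes A: "A \<in> carrier_mat n n" and B: "B \<in> carrier_mat m m"
  shows "num_eigenvalues (four_block_mat A (0\<^sub>m n m) (0\<^sub>m m n) B) P =
    num_eigenvalues A P + num_eigenvalues B P"
proof -
  have "four_block_mat A (0\<^sub>m n m) (0\<^sub>m m n) B \<in> carrier_mat (n + m) (n + m)"
    using A B by simp
  then show ?thesis
    by (simp add: num_eigenvalues_eq[OF A] num_eigenvalues_eq[OF B] num_eigenvalues_eq
        char_poly_block_diag[OF A B] num_roots_mult char_poly_nonzero[OF A] char_poly_nonzero[OF B])
qed

section \<open>Disjoint unions of signed graphs\<close>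

text \<open>The vertices of \<open>H\<close> are moved up by \<open>nverts G\<close>. An edge inside
  \<open>verts G\<close> takes its sign from \<open>G\<close>; any other edge is shifted back and
  takes its sign from \<open>H\<close>.\<close>

definition disjoint_union :: "signed_graph \<Rightarrow> signed_graph \<Rightarrow> signed_graph" where
  "disjoint_union G H = \<lparr>nverts = nverts G + nverts H,
     edges = edges G \<union> (`) ((+) (nverts G)) ` edges H,
     edge_sign = (\<lambda>e. if e \<subseteq> verts G then edge_sign G e
       else edge_sign H ((\<lambda>v. v - nverts G) ` e))\<rparr>"

lemma edge_sub:
  assumes "is_signed_graph G" "e \<in> edges G"
  shows "e \<subseteq> {..<nverts G}" "e \<noteq> {}"
  using assms by (auto simp: is_signed_graph_def verts_def)

lemma unshift: "(\<lambda>v. v - n) ` (+) n ` e = (e :: nat set)"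
  by (simp add: image_comp)

text \<open>Together with \<open>unshift\<close>, this ensures that case distinctions on
  \<open>e \<subseteq> verts G\<close> send shifted edges to the \<open>H\<close> branch and recover
  the original edge there.\<close>

lemma shifted_not_sub:
  assumes "e \<noteq> {}"
  shows "\<not> (+) n ` e \<subseteq> {..<n :: nat}"
  using assms by auto

lemma is_signed_graph_disjoint_union:
  assumes "is_signed_graph G" "is_signed_graph H"
  shows "is_signed_graph (disjoint_union G H)"
proof -
  have "card ((+) (nverts G) ` e) = card e" for e
    by (simp add: card_image)
  then show ?thesis
    using assms by (fastforce simp: is_signed_graph_def disjoint_union_def verts_def)
qed

lemma edges_disjoint_union:
  "edges (disjoint_union G H) = edges G \<union> (`) ((+) (nverts G)) ` edges H"
  by (simp add: disjoint_union_def)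

lemma edge_sign_disjoint_union_left:
  assumes "is_signed_graph G" "e \<in> edges G"
  shows "edge_sign (disjoint_union G H) e = edge_sign G e"
  using edge_sub[OF assms] by (simp add: disjoint_union_def verts_def)

lemma edge_sign_disjoint_union_right:
  assumes "is_signed_graph H" "e \<in> edges H"
  shows "edge_sign (disjoint_union G H) ((+) (nverts G) ` e) = edge_sign H e"
  using edge_sub[OF assms] by (simp add: disjoint_union_def verts_def unshift shifted_not_sub)

lemma edges_of_sign_disjoint_union:
  assumes G: "is_signed_graph G" and H: "is_signed_graph H"
  shows "edges_of_sign (disjoint_union G H) s =
    edges_of_sign G s \<union> (`) ((+) (nverts G)) ` edges_of_sign H s"
proof -
  let ?U = "disjoint_union G H" and ?f = "(`) ((+) (nverts G))"
  have "edges_of_sign ?U s = {e \<in> edges G. edge_sign ?U e = s} \<union>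
      ?f ` {e \<in> edges H. edge_sign ?U (?f e) = s}"
    unfolding edges_of_sign_def edges_disjoint_union by blast
  also have "{e \<in> edges G. edge_sign ?U e = s} = edges_of_sign G s"
    using edge_sign_disjoint_union_left[OF G] by (auto simp: edges_of_sign_def)
  also have "{e \<in> edges H. edge_sign ?U (?f e) = s} = edges_of_sign H s"
    using edge_sign_disjoint_union_right[OF H] by (auto simp: edges_of_sign_def)
  finally show ?thesis .
qed

text \<open>The vertex count and the three component counts are each additive, the latter by
  \<open>card_components_disjoint_union\<close> applied to all edges and to the edges of either
  sign.\<close>

lemma flexibility_disjoint_union:
  assumes G: "is_signed_graph G" and H: "is_signed_graph H"
  shows "flexibility (disjoint_union G H) = flexibility G + flexibility H"
proof -
  have "card (components {..<nverts G + nverts H}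
        (edges_of_sign G s \<union> (`) ((+) (nverts G)) ` edges_of_sign H s)) =
      card (components {..<nverts G} (edges_of_sign G s)) +
      card (components {..<nverts H} (edges_of_sign H s))" for s
    by (rule card_components_disjoint_union)
      (use edge_sub[OF G] edge_sub[OF H] in \<open>auto simp: edges_of_sign_def\<close>)
  moreover have "card (components {..<nverts G + nverts H}
        (edges G \<union> (`) ((+) (nverts G)) ` edges H)) =
      card (components {..<nverts G} (edges G)) + card (components {..<nverts H} (edges H))"
    by (rule card_components_disjoint_union) (use edge_sub[OF G] edge_sub[OF H] in auto)
  ultimately show ?thesis
    unfolding flexibility_def edges_of_sign_disjoint_union[OF G H]
    by (simp add: verts_def disjoint_union_def)
qed

text \<open>Every edge of the union comes from one part and keeps its sign. The composition with the
  shift is the restriction of \<open>\<gamma>\<close> to the copy of \<open>H\<close>, read as a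
  weighting of \<open>H\<close> itself.\<close>

lemma consistent_weighting_disjoint_union:
  assumes G: "is_signed_graph G" and H: "is_signed_graph H"
  shows "consistent_weighting (disjoint_union G H) \<gamma> \<longleftrightarrow>
    consistent_weighting G \<gamma> \<and> consistent_weighting H (\<gamma> \<circ> (`) ((+) (nverts G)))"
  unfolding consistent_weighting_def edges_disjoint_union ball_Un
  by (simp add: edge_sign_disjoint_union_left[OF G] edge_sign_disjoint_union_right[OF H]
      split: sign.splits)

section \<open>Laplacians of disjoint unions\<close>

lemma weighted_degree_disjoint_union_left:
  assumes "i < nverts G"
  shows "weighted_degree (disjoint_union G H) \<gamma> i = weighted_degree G \<gamma> i"
proof -
  have "{e \<in> edges (disjoint_union G H). i \<in> e} = {e \<in> edges G. i \<in> e}"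
    using assms by (auto simp: disjoint_union_def)
  then show ?thesis by (simp add: weighted_degree_def)
qed

text \<open>The edges at the shifted vertex are the shifts of the edges of \<open>H\<close> at
  \<open>i\<close>, and shifting is injective, so the sum can be reindexed.\<close>

lemma weighted_degree_disjoint_union_right:
  assumes G: "is_signed_graph G"
  shows "weighted_degree (disjoint_union G H) \<gamma> (nverts G + i) =
    weighted_degree H (\<gamma> \<circ> (`) ((+) (nverts G))) i"
proof -
  have "{e \<in> edges (disjoint_union G H). nverts G + i \<in> e} =
      (`) ((+) (nverts G)) ` {e \<in> edges H. i \<in> e}"
    using edge_sub[OF G] by (fastforce simp: disjoint_union_def)
  moreover have "inj_on ((`) ((+) (nverts G))) {e \<in> edges H. i \<in> e}"
    by (rule inj_onI) (auto simp: inj_image_eq_iff)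
  ultimately show ?thesis
    by (simp add: weighted_degree_def sum.reindex)
qed

lemma laplacian_carrier: "laplacian G \<gamma> \<in> carrier_mat (nverts G) (nverts G)"
  unfolding laplacian_def weighted_adjacency_def degree_mat_def by (rule carrier_matI) simp_all

lemma laplacian_index:
  assumes "i < nverts G" "j < nverts G"
  shows "laplacian G \<gamma> $$ (i, j) = (if {i, j} \<in> edges G then \<gamma> {i, j} else 0) -
    (if i = j then weighted_degree G \<gamma> i else 0)"
  using assms by (simp add: laplacian_def weighted_adjacency_def degree_mat_def)

text \<open>No edge joins the two parts, so the off-diagonal blocks vanish, and each weighted degree
  depends only on the part of its vertex.\<close>

lemma laplacian_disjoint_union:
  assumes G: "is_signed_graph G" and H: "is_signed_graph H"
  shows "laplacian (disjoint_union G H) \<gamma> =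
    four_block_mat (laplacian G \<gamma>) (0\<^sub>m (nverts G) (nverts H)) (0\<^sub>m (nverts H) (nverts G))
      (laplacian H (\<gamma> \<circ> (`) ((+) (nverts G))))"
    (is "_ = ?R")
proof (rule eq_matI)
  let ?n = "nverts G" and ?m = "nverts H" and ?U = "disjoint_union G H"
  have nU: "nverts ?U = ?n + ?m" by (simp add: disjoint_union_def)
  have carr: "laplacian G \<gamma> \<in> carrier_mat ?n ?n"
    "laplacian H (\<gamma> \<circ> (`) ((+) ?n)) \<in> carrier_mat ?m ?m"
    by (rule laplacian_carrier)+
  show "dim_row (laplacian ?U \<gamma>) = dim_row ?R" "dim_col (laplacian ?U \<gamma>) = dim_col ?R"
    using laplacian_carrier[of ?U \<gamma>] carr by (auto simp: nU)
  fix i j assume "i < dim_row ?R" "j < dim_col ?R"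
  then have ij: "i < ?n + ?m" "j < ?n + ?m" using carr by auto
  \<comment> \<open>Subtraction on naturals truncates at 0; the bounds \<open>x \<ge> ?n\<close> and
    \<open>y \<ge> ?n\<close> exclude vertices of \<open>G\<close> that would otherwise be mistaken
    for vertex 0 of \<open>H\<close>.\<close>
  have edge: "{x, y} \<in> edges ?U \<longleftrightarrow> {x, y} \<in> edges G \<or>
      (x \<ge> ?n \<and> y \<ge> ?n \<and> {x - ?n, y - ?n} \<in> edges H)" for x y
  proof -
    have "{x, y} \<in> (`) ((+) ?n) ` edges H \<longleftrightarrow> x \<ge> ?n \<and> y \<ge> ?n \<and> {x - ?n, y - ?n} \<in> edges H"
    proof
      assume "{x, y} \<in> (`) ((+) ?n) ` edges H"
      then obtain e where e: "e \<in> edges H" "{x, y} = (+) ?n ` e" by auto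
      then have "x \<in> (+) ?n ` e" "y \<in> (+) ?n ` e" by auto
      moreover have "{x - ?n, y - ?n} = e"
        using unshift[of ?n e, folded e(2)] by simp
      ultimately show "x \<ge> ?n \<and> y \<ge> ?n \<and> {x - ?n, y - ?n} \<in> edges H" using e by auto
    next
      assume "x \<ge> ?n \<and> y \<ge> ?n \<and> {x - ?n, y - ?n} \<in> edges H"
      then show "{x, y} \<in> (`) ((+) ?n) ` edges H"
        by (intro image_eqI[where x = "{x - ?n, y - ?n}"]) auto
    qed
    then show ?thesis by (auto simp: disjoint_union_def)
  qed
  have G_lt: "x < ?n \<and> y < ?n" if "{x, y} \<in> edges G" for x y
    using edge_sub[OF G that] by auto
  consider "i < ?n" "j < ?n" | "i < ?n" "j \<ge> ?n" | "i \<ge> ?n" "j < ?n" | "i \<ge> ?n" "j \<ge> ?n"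
    by linarith
  then show "laplacian ?U \<gamma> $$ (i, j) = ?R $$ (i, j)"
  proof cases
    case 1
    then show ?thesis
      using ij carr
      by (simp add: laplacian_index nU edge weighted_degree_disjoint_union_left)
  next
    case 2
    then show ?thesis
      using ij carr G_lt[of i j] by (auto simp: laplacian_index nU edge)
  next
    case 3
    then show ?thesis
      using ij carr G_lt[of i j] by (auto simp: laplacian_index nU edge)
  next
    case 4
    define a b where "a = i - ?n" and "b = j - ?n"
    have ab: "i = ?n + a" "j = ?n + b" using 4 by (auto simp: a_def b_def)
    show ?thesis
      using ij carr G_lt[of i j] weighted_degree_disjoint_union_right[OF G, of H \<gamma> a]
      by (auto simp: laplacian_index nU edge ab)
  qed
qed

section \<open>Inertias of disjoint unions\<close>

definition add_triple :: "nat \<times> nat \<times> nat \<Rightarrow> nat \<times> nat \<times> nat \<Rightarrow> nat \<times> nat \<times> nat" where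
  "add_triple s t = (fst s + fst t, fst (snd s) + fst (snd t), snd (snd s) + snd (snd t))"

lemma laplacian_inertia_disjoint_union:
  assumes "is_signed_graph G" "is_signed_graph H"
  shows "laplacian_inertia (disjoint_union G H) \<gamma> =
    add_triple (laplacian_inertia G \<gamma>) (laplacian_inertia H (\<gamma> \<circ> (`) ((+) (nverts G))))"
  unfolding laplacian_inertia_def laplacian_disjoint_union[OF assms]
    num_eigenvalues_block_diag[OF laplacian_carrier laplacian_carrier]
  by (simp add: add_triple_def)

text \<open>Weightings are functions on all vertex sets, but only their values on edges enter the
  Laplacian. A weighting glued from two parts agrees with the given ones on edges only.\<close>

lemma laplacian_cong:
  assumes "\<And>e. e \<in> edges G \<Longrightarrow> \<gamma> e = \<gamma>' e"
  shows "laplacian G \<gamma> = laplacian G \<gamma>'"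
proof -
  have degree: "weighted_degree G \<gamma> = weighted_degree G \<gamma>'"
    using assms by (auto simp: weighted_degree_def fun_eq_iff intro!: sum.cong)
  have adjacency: "weighted_adjacency G \<gamma> = weighted_adjacency G \<gamma>'"
    using assms by (auto simp: weighted_adjacency_def intro!: eq_matI)
  show ?thesis unfolding laplacian_def degree_mat_def degree adjacency ..
qed

text \<open>The weights on the two parts can be chosen independently, so the achieved triples form
  the sumset of those achieved by the parts.\<close>

lemma achieves_disjoint_union:
  assumes G: "is_signed_graph G" and H: "is_signed_graph H"
  shows "achieves (disjoint_union G H) t \<longleftrightarrow>
    (\<exists>r s. achieves G r \<and> achieves H s \<and> t = add_triple r s)"
proof
  assume "achieves (disjoint_union G H) t"
  then show "\<exists>r s. achieves G r \<and> achieves H s \<and> t = add_triple r s"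
    unfolding achieves_def
    using laplacian_inertia_disjoint_union[OF G H] consistent_weighting_disjoint_union[OF G H]
    by metis
next
  assume "\<exists>r s. achieves G r \<and> achieves H s \<and> t = add_triple r s"
  then obtain \<alpha> \<beta> where \<alpha>: "consistent_weighting G \<alpha>" and \<beta>: "consistent_weighting H \<beta>"
    and t: "t = add_triple (laplacian_inertia G \<alpha>) (laplacian_inertia H \<beta>)"
    unfolding achieves_def by blast
  \<comment> \<open>The two weightings are glued by the same case distinction as in
    \<open>edge_sign\<close> of the union.\<close>
  define \<gamma> where "\<gamma> = (\<lambda>e. if e \<subseteq> verts G then \<alpha> e else \<beta> ((\<lambda>v. v - nverts G) ` e))"
  have g: "\<gamma> e = \<alpha> e" if "e \<in> edges G" for e
    using edge_sub[OF G that] by (simp add: \<gamma>_def verts_def)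
  have h: "(\<gamma> \<circ> (`) ((+) (nverts G))) e = \<beta> e" if "e \<in> edges H" for e
    using edge_sub[OF H that] by (simp add: \<gamma>_def verts_def unshift shifted_not_sub)
  have "consistent_weighting (disjoint_union G H) \<gamma>"
    unfolding consistent_weighting_disjoint_union[OF G H]
    using \<alpha> \<beta> g h by (simp add: consistent_weighting_def split: sign.splits)
  moreover have "laplacian_inertia (disjoint_union G H) \<gamma> = t"
    unfolding laplacian_inertia_disjoint_union[OF G H] t
  proof -
    have "laplacian G \<gamma> = laplacian G \<alpha>"
      "laplacian H (\<gamma> \<circ> (`) ((+) (nverts G))) = laplacian H \<beta>"
      by (rule laplacian_cong; fact g h)+
    then show "add_triple (laplacian_inertia G \<gamma>)
        (laplacian_inertia H (\<gamma> \<circ> (`) ((+) (nverts G)))) =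
        add_triple (laplacian_inertia G \<alpha>) (laplacian_inertia H \<beta>)"
      by (simp only: laplacian_inertia_def)
  qed
  ultimately show "achieves (disjoint_union G H) t"
    unfolding achieves_def by blast
qed

section \<open>The single vertex and the triangle with one negative edge\<close>

definition single_vertex :: signed_graph where
  "single_vertex = \<lparr>nverts = 1, edges = {}, edge_sign = (\<lambda>_. Plus)\<rparr>"

lemma is_signed_graph_single_vertex: "is_signed_graph single_vertex"
  by (simp add: is_signed_graph_def single_vertex_def)

lemma card_components_const:
  assumes "\<And>e. e \<in> E \<Longrightarrow> e \<subseteq> V" "V \<noteq> {}"
    and "\<And>x y. x \<in> V \<Longrightarrow> y \<in> V \<Longrightarrow> (x, y) \<in> {(x, y). {x, y} \<in> E}\<^sup>*"
  shows "card (components V E) = 1"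
  using card_components_eq[of V E "\<lambda>_. True"] assms by (simp add: image_constant_conv)

lemma flexibility_single_vertex: "flexibility single_vertex = 0"
proof -
  have "card (components {0} {}) = 1"
    by (rule card_components_const) auto
  then show ?thesis
    by (simp add: flexibility_def single_vertex_def verts_def edges_of_sign_def lessThan_Suc)
qed

lemma achieves_single_vertex: "achieves single_vertex t \<longleftrightarrow> t = (0, 0, 1)"
proof -
  have "laplacian_inertia single_vertex \<gamma> = (0, 0, 1)" for \<gamma>
  proof -
    have carr: "laplacian single_vertex \<gamma> \<in> carrier_mat 1 1"
      using laplacian_carrier[of single_vertex \<gamma>] by (simp add: single_vertex_def)
    have "laplacian single_vertex \<gamma> $$ (0, 0) = 0"
      by (simp add: laplacian_index single_vertex_def weighted_degree_def)
    \<comment> \<open>The polynomial \<open>x\<close> is written with the root 0 visible, to match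
      \<open>num_roots_linear\<close>.\<close>
    then have "char_poly (laplacian single_vertex \<gamma>) = [:- 0, 1:]"
      unfolding char_poly_def
      using carr by (subst det_single) (auto simp: char_poly_matrix_def)
    then show ?thesis
      unfolding laplacian_inertia_def num_eigenvalues_eq[OF carr] by (simp only: num_roots_linear) simp
  qed
  moreover have "consistent_weighting single_vertex (\<lambda>_. 0)"
    by (simp add: consistent_weighting_def single_vertex_def)
  ultimately show ?thesis by (auto simp: achieves_def)
qed

definition triangle :: signed_graph where
  "triangle = \<lparr>nverts = 3, edges = {{0, 1}, {1, 2}, {0, 2}},
     edge_sign = (\<lambda>e. if e = {0, 2} then Minus else Plus)\<rparr>"

lemma is_signed_graph_triangle: "is_signed_graph triangle"
  by (auto simp: is_signed_graph_def triangle_def verts_def)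

text \<open>The positive edges form a spanning path, while the negative edge leaves vertex 1
  isolated, so the value is 3 + 1 - 1 - 2.\<close>

lemma flexibility_triangle: "flexibility triangle = 1"
proof -
  have verts: "verts triangle = {0, 1, 2}"
    by (auto simp: verts_def triangle_def)
  have "e \<in> edges_of_sign triangle Plus \<longleftrightarrow> e \<in> {{0, 1}, {1, 2}}"
    "e \<in> edges_of_sign triangle Minus \<longleftrightarrow> e \<in> {{0, 2}}" for e
    by (cases "e = {0, 2}"; simp add: edges_of_sign_def triangle_def doubleton_eq_iff)+
  then have plus: "edges_of_sign triangle Plus = {{0, 1}, {1, 2}}"
    and minus: "edges_of_sign triangle Minus = {{0, 2}}"
    by blast+
  have path: "(x, y) \<in> {(x, y). {x, y} \<in> {{0, 1}, {1, 2 :: nat}}}\<^sup>*"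
    if "x \<in> {0, 1, 2}" "y \<in> {0, 1, 2}" for x y
  proof -
    define R :: "(nat \<times> nat) set" where "R = {(x, y). {x, y} \<in> {{0, 1}, {1, 2}}}"
    have "(0, 1) \<in> R" "(1, 0) \<in> R" "(1, 2) \<in> R" "(2, 1) \<in> R"
      by (simp_all add: R_def doubleton_eq_iff)
    \<comment> \<open>Every vertex equals or is adjacent to the middle vertex 1 of the path, so all
      walks can pass through it.\<close>
    then have "(x, 1) \<in> R\<^sup>*" "(1, y) \<in> R\<^sup>*"
      using that by auto
    then show ?thesis unfolding R_def by (rule rtrancl_trans)
  qed
  have "card (components {0, 1, 2} {{0, 1}, {1, 2}}) = 1"
    by (rule card_components_const) (use path in auto)
  moreover have "card (components {0, 1, 2} {{0, 1}, {1, 2}, {0, 2}}) = 1"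
  proof (rule card_components_const)
    fix x y :: nat assume "x \<in> {0, 1, 2}" "y \<in> {0, 1, 2}"
    from path[OF this] show "(x, y) \<in> {(x, y). {x, y} \<in> {{0, 1}, {1, 2}, {0, 2}}}\<^sup>*"
      by (rule reach_mono) simp
  qed auto
  \<comment> \<open>The label \<open>v = 1\<close> separates the isolated vertex from the two
    endpoints of the negative edge.\<close>
  moreover have "card (components {0, 1, 2} {{0, 2}}) = card ((\<lambda>v. v = 1) ` {0, 1, 2 :: nat})"
  proof (rule card_components_eq)
    fix x y :: nat assume "x \<in> {0, 1, 2}" "y \<in> {0, 1, 2}" "(x = 1) = (y = 1)"
    then have "x = y \<or> {x, y} = {0, 2}" by (auto simp: doubleton_eq_iff)
    then show "(x, y) \<in> {(x, y). {x, y} \<in> {{0, 2}}}\<^sup>*"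
    proof
      assume "{x, y} = {0, 2}"
      then have "(x, y) \<in> {(x, y). {x, y} \<in> {{0, 2}}}" by simp
      then show ?thesis by (rule r_into_rtrancl)
    qed simp
  qed (auto simp: doubleton_eq_iff)
  moreover have "(\<lambda>v. v = 1) ` {0, 1, 2 :: nat} = {False, True}" by auto
  ultimately show ?thesis
    unfolding flexibility_def verts plus minus
    by (simp add: triangle_def)
qed

section \<open>Spectrum of the triangle\<close>

lemma det_2:
  assumes "A \<in> carrier_mat 2 2"
  shows "det A = A $$ (0, 0) * A $$ (1, 1) - A $$ (0, 1) * A $$ (1, 0)"
proof -
  have "det (mat_delete A 0 j) = mat_delete A 0 j $$ (0, 0)" for j
    by (rule det_single) (use assms in \<open>auto simp: mat_delete_def\<close>)
  then show ?thesis
    using assms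
    by (subst laplace_expansion_row[OF assms, of 0])
      (auto simp: cofactor_def mat_delete_def numeral_2_eq_2 algebra_simps)
qed

lemma det_3:
  assumes "A \<in> carrier_mat 3 3"
  shows "det A = A $$ (0, 0) * (A $$ (1, 1) * A $$ (2, 2) - A $$ (1, 2) * A $$ (2, 1))
    - A $$ (0, 1) * (A $$ (1, 0) * A $$ (2, 2) - A $$ (1, 2) * A $$ (2, 0))
    + A $$ (0, 2) * (A $$ (1, 0) * A $$ (2, 1) - A $$ (1, 1) * A $$ (2, 0))"
proof -
  have carr: "mat_delete A 0 j \<in> carrier_mat 2 2" for j
    using assms by (auto simp: mat_delete_def)
  have idx: "mat_delete A 0 j $$ (i, k) = A $$ (Suc i, if k < j then k else Suc k)"
    if "i < 2" "k < 2" for i j k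
    using that assms by (auto simp: mat_delete_def)
  have "det A = A $$ (0, 0) * det (mat_delete A 0 0) - A $$ (0, 1) * det (mat_delete A 0 1)
      + A $$ (0, 2) * det (mat_delete A 0 2)"
    by (subst laplace_expansion_row[OF assms, of 0])
      (simp_all add: cofactor_def numeral_3_eq_3 numeral_2_eq_2)
  then show ?thesis
    by (simp add: det_2[OF carr] idx numeral_2_eq_2)
qed

text \<open>The factor \<open>x\<close> reflects the zero row sums. In the quadratic factor the
  linear coefficient is minus the trace, and the constant one is the sum of the three principal 2 by
  2 minors, each equal to the weighted count of spanning trees. Here \<open>w\<close> is the signed
  weight of the edge \<open>{0, 2}\<close>.\<close>

lemma char_poly_triangle:
  fixes \<gamma> :: "nat set \<Rightarrow> real"
  defines "u \<equiv> \<gamma> {0, 1}" and "v \<equiv> \<gamma> {1, 2}" and "w \<equiv> \<gamma> {0, 2}"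
  shows "char_poly (laplacian triangle \<gamma>) =
    [:0, 1:] * [:3 * (u * v + u * w + v * w), 2 * (u + v + w), 1:]"
proof -
  let ?L = "laplacian triangle \<gamma>"
  have carr: "?L \<in> carrier_mat 3 3"
    using laplacian_carrier[of triangle \<gamma>] by (simp add: triangle_def)
  have ne: "{0, 1} \<noteq> {1, 2 :: nat}" "{0, 1} \<noteq> {0, 2 :: nat}" "{1, 2} \<noteq> {0, 2 :: nat}"
    by (auto simp: doubleton_eq_iff)
  have "{e \<in> edges triangle. 0 \<in> e} = {{0, 1}, {0, 2}}"
    "{e \<in> edges triangle. 1 \<in> e} = {{0, 1}, {1, 2}}"
    "{e \<in> edges triangle. 2 \<in> e} = {{1, 2}, {0, 2}}"
    by (auto simp: triangle_def)
  then have deg: "weighted_degree triangle \<gamma> 0 = u + w"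
    "weighted_degree triangle \<gamma> 1 = u + v" "weighted_degree triangle \<gamma> 2 = v + w"
    using ne by (simp_all add: weighted_degree_def u_def v_def w_def)
  have idx: "?L $$ (0, 0) = - (u + w)" "?L $$ (0, 1) = u" "?L $$ (0, 2) = w"
    "?L $$ (1, 0) = u" "?L $$ (1, 1) = - (u + v)" "?L $$ (1, 2) = v"
    "?L $$ (2, 0) = w" "?L $$ (2, 1) = v" "?L $$ (2, 2) = - (v + w)"
    using deg by (subst laplacian_index; simp add: triangle_def u_def v_def w_def
        insert_commute doubleton_eq_iff singleton_insert_inj_eq)+
  have cm: "char_poly_matrix ?L $$ (i, j) = (if i = j then [:0, 1:] else 0) + [:- ?L $$ (i, j):]"
    if "i < 3" "j < 3" for i j
    using that carr by (auto simp: char_poly_matrix_def)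
  show ?thesis
    unfolding char_poly_def
    \<comment> \<open>The entries are supplied a second time with index \<open>1\<close> as
      \<open>Suc 0\<close>, the form it takes under simplification.\<close>
    using carr by (subst det_3) (auto simp: cm idx idx[unfolded One_nat_def] algebra_simps)
qed

text \<open>This is the quadratic formula. The sum and product of the roots are kept because the
  signs of the roots are later read off from them.\<close>

lemma quadratic_factors:
  fixes p q :: real
  assumes "p\<^sup>2 \<ge> 4 * q"
  obtains r s where "r + s = - p" "r * s = q" "[:q, p, 1:] = [:- r, 1:] * [:- s, 1:]"
proof -
  define d where "d = sqrt (p\<^sup>2 - 4 * q)"
  have d: "d * d = p * p - 4 * q"
    using assms by (simp add: d_def power2_eq_square)
  show thesis
  proof (rule that[of "(- p + d) / 2" "(- p - d) / 2"])
    show "(- p + d) / 2 + (- p - d) / 2 = - p" by (simp add: field_simps)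
    show "(- p + d) / 2 * ((- p - d) / 2) = q" using d by (simp add: field_simps)
    then show "[:q, p, 1:] = [:- ((- p + d) / 2), 1:] * [:- ((- p - d) / 2), 1:]"
      by (simp add: field_simps)
  qed
qed

text \<open>The eigenvalues are 0 and two reals \<open>r\<close>, \<open>s\<close> with sum
  \<open>-p\<close> and product \<open>q\<close>. If \<open>q < 0\<close> their signs are opposite;
  if \<open>q = 0\<close> they are 0 and \<open>-p\<close>; if \<open>q > 0\<close> they share a
  sign. In the last two cases \<open>p > 0\<close> makes the nonzero ones negative.\<close>

lemma laplacian_inertia_triangle:
  assumes "u > 0" "v > 0" "w > 0" and "\<gamma> {0, 1} = u" "\<gamma> {1, 2} = v" "\<gamma> {0, 2} = - w"
  shows "laplacian_inertia triangle \<gamma> =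
    (if u * v < w * (u + v) then (1, 1, 1) else if u * v = w * (u + v) then (0, 1, 2)
     else (0, 2, 1))"
proof -
  define p q where "p = 2 * (u + v - w)" and "q = 3 * (u * v - w * (u + v))"
  \<comment> \<open>All terms on the right are nonnegative for positive \<open>u\<close>,
    \<open>v\<close>, \<open>w\<close>, so both roots of the quadratic are real.\<close>
  have discriminant: "p\<^sup>2 - 4 * q = 4 * ((u - v)\<^sup>2 + u * v + u * w + v * w + w\<^sup>2)"
    by (simp add: p_def q_def power2_eq_square algebra_simps)
  have "p\<^sup>2 - 4 * q \<ge> 0"
    unfolding discriminant using assms by (intro mult_nonneg_nonneg add_nonneg_nonneg) auto
  then have "p\<^sup>2 \<ge> 4 * q" by simp
  then obtain r s where rs: "r + s = - p" "r * s = q" "[:q, p, 1:] = [:- r, 1:] * [:- s, 1:]"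
    by (rule quadratic_factors)
  have "q \<ge> 0 \<Longrightarrow> p > 0"
  proof -
    assume "q \<ge> 0"
    then have "w * (u + v) \<le> u * v" by (simp add: q_def)
    also have "\<dots> < (u + v) * (u + v)" using assms by (simp add: algebra_simps add_pos_pos)
    finally have "w < u + v" using assms by simp
    then show "p > 0" by (simp add: p_def)
  qed
  have "char_poly (laplacian triangle \<gamma>) = [:0, 1:] * [:q, p, 1:]"
    unfolding char_poly_triangle assms(4-6) by (simp add: p_def q_def algebra_simps)
  also have "\<dots> = [:- 0, 1:] * ([:- r, 1:] * [:- s, 1:])"
    by (simp only: rs minus_zero)
  finally have cp: "char_poly (laplacian triangle \<gamma>) = [:- 0, 1:] * ([:- r, 1:] * [:- s, 1:])" .
  have carr: "laplacian triangle \<gamma> \<in> carrier_mat 3 3"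
    using laplacian_carrier[of triangle \<gamma>] by (simp add: triangle_def)
  \<comment> \<open>Each linear factor contributes one eigenvalue; coinciding roots are counted
    correctly because multiplicities add over factors.\<close>
  have num: "num_eigenvalues (laplacian triangle \<gamma>) P =
      of_bool (P 0) + of_bool (P r) + of_bool (P s)" for P
  proof -
    have "[:- r, 1:] * [:- s, 1:] \<noteq> 0" "[:- 0, 1::real:] \<noteq> 0" "[:- r, 1:] \<noteq> 0" "[:- s, 1:] \<noteq> 0"
      by (simp_all only: mult_eq_0_iff pCons_eq_0_iff) simp_all
    then show ?thesis
      unfolding num_eigenvalues_eq[OF carr] cp
      by (simp only: num_roots_mult num_roots_linear mult_eq_0_iff simp_thms of_bool_def add.assoc)
  qed
  consider "q < 0" | "q = 0" | "q > 0" by linarith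
  then show ?thesis
  proof cases
    case 1
    then have "r > 0 \<and> s < 0 \<or> r < 0 \<and> s > 0"
      using rs(2) mult_less_0_iff by metis
    moreover have "u * v < w * (u + v)" using 1 by (simp add: q_def)
    ultimately show ?thesis by (auto simp: laplacian_inertia_def num)
  next
    case 2
    then have "r = 0 \<and> s < 0 \<or> r < 0 \<and> s = 0"
      using rs(1,2) \<open>q \<ge> 0 \<Longrightarrow> p > 0\<close> by auto
    moreover have "u * v = w * (u + v)" using 2 by (simp add: q_def)
    ultimately show ?thesis by (auto simp: laplacian_inertia_def num)
  next
    case 3
    then have "r < 0" "s < 0"
      using rs(1,2) \<open>q \<ge> 0 \<Longrightarrow> p > 0\<close> zero_less_mult_iff[of r s] by auto
    moreover have "u * v > w * (u + v)" using 3 by (simp add: q_def)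
    ultimately show ?thesis by (auto simp: laplacian_inertia_def num)
  qed
qed

lemma consistent_weighting_triangle:
  "consistent_weighting triangle \<gamma> \<longleftrightarrow> \<gamma> {0, 1} > 0 \<and> \<gamma> {1, 2} > 0 \<and> \<gamma> {0, 2} < 0"
  by (auto simp: consistent_weighting_def triangle_def doubleton_eq_iff)

lemma achieves_triangle: "achieves triangle t \<longleftrightarrow> t \<in> {(1, 1, 1), (0, 2, 1), (0, 1, 2)}"
proof
  assume "achieves triangle t"
  then obtain \<gamma> where "consistent_weighting triangle \<gamma>" "laplacian_inertia triangle \<gamma> = t"
    by (auto simp: achieves_def)
  then show "t \<in> {(1, 1, 1), (0, 2, 1), (0, 1, 2)}"
    using laplacian_inertia_triangle[of "\<gamma> {0, 1}" "\<gamma> {1, 2}" "- \<gamma> {0, 2}" \<gamma>]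
    by (auto simp: consistent_weighting_triangle split: if_splits)
next
  \<comment> \<open>With \<open>u = v = 2\<close> the comparison of \<open>u * v\<close> with
    \<open>w * (u + v)\<close> becomes that of 4 with \<open>4 * w\<close>. The values 2, 1 and 1/2
    of \<open>w\<close> then realise the three cases.\<close>
  define \<gamma> :: "real \<Rightarrow> nat set \<Rightarrow> real" where "\<gamma> = (\<lambda>w e. if e = {0, 2} then - w else 2)"
  have "achieves triangle (if 4 < w * 4 then (1, 1, 1) else if 4 = w * 4 then (0, 1, 2)
      else (0, 2, 1))" if "w > 0" for w :: real
    unfolding achieves_def
  proof (intro exI conjI)
    show "consistent_weighting triangle (\<gamma> w)"
      using that by (auto simp: consistent_weighting_triangle \<gamma>_def doubleton_eq_iff)
    show "laplacian_inertia triangle (\<gamma> w) =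
        (if 4 < w * 4 then (1, 1, 1) else if 4 = w * 4 then (0, 1, 2) else (0, 2, 1))"
      using laplacian_inertia_triangle[of 2 2 w "\<gamma> w"] that
      by (auto simp: \<gamma>_def doubleton_eq_iff)
  qed
  from this[of 2] this[of 1] this[of "1 / 2"]
  have "achieves triangle (1, 1, 1)" "achieves triangle (0, 1, 2)" "achieves triangle (0, 2, 1)"
    by simp_all
  moreover assume "t \<in> {(1, 1, 1), (0, 2, 1), (0, 1, 2)}"
  ultimately show "achieves triangle t" by auto
qed

section \<open>Disjoint unions of triangles\<close>

primrec triangles :: "nat \<Rightarrow> signed_graph" where
  "triangles 0 = single_vertex"
| "triangles (Suc k) = disjoint_union (triangles k) triangle"

lemma is_signed_graph_triangles: "is_signed_graph (triangles k)"
  by (induction k)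
    (simp_all add: is_signed_graph_single_vertex is_signed_graph_triangle
      is_signed_graph_disjoint_union)

lemma flexibility_triangles: "flexibility (triangles k) = int k"
  by (induction k)
    (simp_all add: flexibility_single_vertex flexibility_triangle flexibility_disjoint_union
      is_signed_graph_triangles is_signed_graph_triangle)

text \<open>Each triangle contributes \<open>(0, 1, 1)\<close> plus a unit vector; \<open>a\<close>,
  \<open>b\<close>, \<open>c\<close> count the triangles whose unit vector lies in the first, second
  or third position. The extra 1 in the last entry comes from the isolated vertex.\<close>

lemma achieves_triangles:
  "achieves (triangles k) t \<longleftrightarrow> (\<exists>a b c. a + b + c = k \<and> t = (a, k + b, 1 + k + c))"
proof (induction k arbitrary: t)
  case 0
  then show ?case by (auto simp: achieves_single_vertex)
next
  case (Suc k)
  have "achieves (triangles (Suc k)) t \<longleftrightarrow> (\<exists>a b c. a + b + c = k \<and>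
      (\<exists>s\<in>{(1, 1, 1), (0, 2, 1), (0, 1, 2)}. t = add_triple (a, k + b, 1 + k + c) s))"
    unfolding triangles.simps
      achieves_disjoint_union[OF is_signed_graph_triangles is_signed_graph_triangle]
      Suc.IH achieves_triangle
    by blast
  also have "\<dots> \<longleftrightarrow> (\<exists>a b c. a + b + c = k \<and>
      (t = (Suc a, Suc k + b, 1 + Suc k + c) \<or> t = (a, Suc k + Suc b, 1 + Suc k + c) \<or>
       t = (a, Suc k + b, 1 + Suc k + Suc c)))"
    by (simp add: add_triple_def)
  also have "\<dots> \<longleftrightarrow> (\<exists>a b c. a + b + c = Suc k \<and> t = (a, Suc k + b, 1 + Suc k + c))"
    (is "?L \<longleftrightarrow> ?R")
  proof
    assume ?L
    then obtain a b c where abc: "a + b + c = k" and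
      "t = (Suc a, Suc k + b, 1 + Suc k + c) \<or> t = (a, Suc k + Suc b, 1 + Suc k + c) \<or>
       t = (a, Suc k + b, 1 + Suc k + Suc c)" by blast
    moreover have "Suc a + b + c = Suc k" "a + Suc b + c = Suc k" "a + b + Suc c = Suc k"
      using abc by simp_all
    ultimately show ?R by blast
  next
    assume ?R
    then obtain a b c where abc: "a + b + c = Suc k" and t: "t = (a, Suc k + b, 1 + Suc k + c)"
      by blast
    \<comment> \<open>The sum is positive, so some kind of triangle occurs, and one of that kind is
      assigned to the last triangle added.\<close>
    then consider a' where "a = Suc a'" | b' where "b = Suc b'" | c' where "c = Suc c'"
      by (cases a; cases b; cases c) auto
    then show ?L
    proof cases
      case 1
      then have "a' + b + c = k" using abc by simp
      then show ?thesis using t 1 by blast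
    next
      case 2
      then have "a + b' + c = k" using abc by simp
      then show ?thesis using t 2 by blast
    next
      case 3
      then have "a + b + c' = k" using abc by simp
      then show ?thesis using t 3 by blast
    qed
  qed
  finally show ?case .
qed

text \<open>A triple is determined by \<open>a\<close> and \<open>b\<close> with
  \<open>a + b \<le> k\<close>, since \<open>c\<close> is the remainder. The number of such pairs is
  a triangular number.\<close>

lemma card_achieved_triangles: "card {t. achieves (triangles k) t} = (k + 2) choose 2"
proof -
  define f where "f = (\<lambda>(a, b). (a, k + b, 1 + k + (k - a - b)))"
  have "{t. achieves (triangles k) t} = f ` (SIGMA a : {..k}. {..k - a})"
  proof (intro Set.set_eqI iffI)
    fix t assume "t \<in> {t. achieves (triangles k) t}"
    then obtain a b c where "a + b + c = k" "t = (a, k + b, 1 + k + c)"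
      by (auto simp: achieves_triangles)
    then show "t \<in> f ` (SIGMA a : {..k}. {..k - a})"
      by (intro image_eqI[of _ _ "(a, b)"]) (auto simp: f_def)
  next
    fix t assume "t \<in> f ` (SIGMA a : {..k}. {..k - a})"
    then obtain a b where "a \<le> k" "b \<le> k - a" "t = (a, k + b, 1 + k + (k - a - b))"
      by (auto simp: f_def)
    then show "t \<in> {t. achieves (triangles k) t}"
      by (auto simp: achieves_triangles intro!: exI[of _ "k - a - b"])
  qed
  moreover have "inj_on f (SIGMA a : {..k}. {..k - a})"
    by (auto simp: inj_on_def f_def)
  ultimately have "card {t. achieves (triangles k) t} = (\<Sum>a\<le>k. Suc (k - a))"
    by (simp add: card_image)
  \<comment> \<open>Reversing the order of summation frees the summands of \<open>k\<close>, which
    makes the sum accessible to induction.\<close>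
  also have "\<dots> = (\<Sum>a\<le>k. Suc a)"
    by (rule sum.reindex_bij_witness[where i = "\<lambda>a. k - a" and j = "\<lambda>a. k - a"]) auto
  also have "\<dots> = (k + 2) choose 2"
    by (induction k) (simp_all add: numeral_2_eq_2)
  finally show ?thesis .
qed

theorem theorem3p7:
  fixes \<tau> :: nat
  shows "\<exists>G. is_signed_graph G \<and> flexibility G = int \<tau> \<and>
           card {t. achieves G t} = (\<tau> + 2) choose 2"
  using is_signed_graph_triangles flexibility_triangles card_achieved_triangles by blast

end
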